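(* Let $\mathfrak{g}$ be a vector space over $\mathbb{K}$ and $\alpha:\mathfrak{g}\to\mathfrak{g}$ a linear map. There is a one-to-one correspondence between compatible Hom-Lie algebra structures on $\mathfrak{g}$ (with twisting map $\alpha$) and Maurer-Cartan elements in the bidifferential graded Lie algebra $(C^{\ast+1}_{\mathrm{Hom}}(\mathfrak{g},\mathfrak{g}),[~,~]_{\mathsf{NR}},d_1=0,d_2=0)$.
   Context: $\mathbb{K}$ is a field of characteristic zero. A Hom-Lie algebra $(\mathfrak{g},[~,~],\alpha)$ is a vector space $\mathfrak{g}$ with a bilinear skew-symmetric bracket and a linear map $\alpha:\mathfrak{g}\to\mathfrak{g}$ such that $\alpha[x,y]=[\alpha(x),\alpha(y)]$ and $[[x,y],\alpha(z)]+[[y,z],\alpha(x)]+[[z,x],\alpha(y)]=0$ for all $x,y,z\in\mathfrak{g}$. A compatible Hom-Lie algebra $(\mathfrak{g},[~,~]_1,[~,~]_2,\alpha)$ consists of two Hom-Lie algebras $(\mathfrak{g},[~,~]_1,\alpha)$, $(\mathfrak{g},[~,~]_2,\alpha)$ such that $(\mathfrak{g},\lambda[~,~]_1+\eta[~,~]_2,\alpha)$ is a Hom-Lie algebra for all $\lambda,\eta\in\mathbb{K}$; then the pair $([~,~]_1,[~,~]_2)$ is called a compatible Hom-Lie algebra structure on $\mathfrak{g}$. For $n\ge 1$, $C^n_{\mathrm{Hom}}(\mathfrak{g},\mathfrak{g})=\{f:\wedge^n\mathfrak{g}\to\mathfrak{g}\text{ linear}\mid \alpha\circ f=f\circ\alpha^{\wedge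 n}\}$. The graded space $C^{\ast+1}_{\mathrm{Hom}}(\mathfrak{g},\mathfrak{g})=\bigoplus_{n\ge0}C^{n+1}_{\mathrm{Hom}}(\mathfrak{g},\mathfrak{g})$, with $C^{n+1}_{\mathrm{Hom}}$ in degree $n$, is a graded Lie algebra with the Nijenhuis-Richardson bracket: for $P\in C^{m+1}_{\mathrm{Hom}}(\mathfrak{g},\mathfrak{g})$, $Q\in C^{n+1}_{\mathrm{Hom}}(\mathfrak{g},\mathfrak{g})$, $$[P,Q]_{\mathsf{NR}}=P\diamond Q-(-1)^{mn}Q\diamond P,$$ $$(P\diamond Q)(x_1,\ldots,x_{m+n+1})=\sum_{\sigma\in Sh(n+1,m)}(-1)^\sigma P\big(Q(x_{\sigma(1)},\ldots,x_{\sigma(n+1)}),\alpha^n(x_{\sigma(n+2)}),\ldots,\alpha^n(x_{\sigma(m+n+1)})\big),$$ where $Sh(n+1,m)$ is the set of $(n+1,m)$-shuffles and $(-1)^\sigma$ is the sign of $\sigma$. A bidifferential graded Lie algebra $(L=\oplus L^i,[~,~],d_1,d_2)$ is a graded Lie algebra with two degree $+1$ differentials $d_1,d_2$, each a derivation of the bracket, with $d_1\circ d_2+d_2\circ d_1=0$; any graded Lie algebra is one with $d_1=d_2=0$. A Maurer-Cartan element in it is a pair $(\theta_1,\theta_2)\in L^1\oplus L^1$ with $d_1\theta_1+\tfrac12[\theta_1,\theta_1]=0$, $d_2\theta_2+\tfrac12[\theta_2,\theta_2]=0$ and $d_1\theta_2+d_2\theta_1+[\theta_1,\theta_2]=0$.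 *)

theory Defs
  imports Complex_Main "HOL-Combinatorics.Permutations" "HOL-Library.Function_Algebras"
begin

locale hom_lie_algebra = vector_space scale
  for scale :: "'k::field_char_0 \<Rightarrow> 'g::ab_group_add \<Rightarrow> 'g" +
  fixes br :: "'g \<Rightarrow> 'g \<Rightarrow> 'g" and \<alpha> :: "'g \<Rightarrow> 'g"
  assumes linear_left: "\<And>y. Vector_Spaces.linear scale scale (\<lambda>x. br x y)"
    and linear_right: "\<And>x. Vector_Spaces.linear scale scale (\<lambda>y. br x y)"
    and skew: "\<And>x y. br x y = - br y x"
    and linear_twist: "Vector_Spaces.linear scale scale \<alpha>"
    and multiplicative: "\<And>x y. \<alpha> (br x y) = br (\<alpha> x) (\<alpha> y)"
    and hom_jacobi: "\<And>x y z. br (br x y) (\<alpha> z) + br (br y z) (\<alpha> x) + br (br z x) (\<alpha> y) = 0"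

locale compatible_hom_lie_algebra =
  fst: hom_lie_algebra scale br1 \<alpha> + snd: hom_lie_algebra scale br2 \<alpha>
  for scale :: "'k::field_char_0 \<Rightarrow> 'g::ab_group_add \<Rightarrow> 'g"
    and br1 br2 :: "'g \<Rightarrow> 'g \<Rightarrow> 'g" and \<alpha> :: "'g \<Rightarrow> 'g" +
  assumes compatible:
    "\<And>l e. hom_lie_algebra scale (\<lambda>x y. scale l (br1 x y) + scale e (br2 x y)) \<alpha>"

definition compatible_hom_lie_structures ::
  "('k::field_char_0 \<Rightarrow> 'g::ab_group_add \<Rightarrow> 'g) \<Rightarrow> ('g \<Rightarrow> 'g) \<Rightarrow>
    (('g \<Rightarrow> 'g \<Rightarrow> 'g) \<times> ('g \<Rightarrow> 'g \<Rightarrow> 'g)) set"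
  where "compatible_hom_lie_structures scale \<alpha> =
    {(br1, br2). compatible_hom_lie_algebra scale br1 br2 \<alpha>}"

text \<open>A linear map from the n-th exterior power of \<open>'g\<close> to \<open>'g\<close> is represented by the
  corresponding alternating multilinear map on lists of length \<open>n\<close>.  It is extended by zero to
  lists of any other length, so that distinct functions are distinct cochains and the vector
  space operations are pointwise.\<close>

definition hom_cochains ::
  "('k::field_char_0 \<Rightarrow> 'g::ab_group_add \<Rightarrow> 'g) \<Rightarrow> ('g \<Rightarrow> 'g) \<Rightarrow> nat \<Rightarrow> ('g list \<Rightarrow> 'g) set"
  where "hom_cochains scale \<alpha> n = {f.
    (\<forall>xs. length xs \<noteq> n \<longrightarrow> f xs = 0) \<and>
    (\<forall>xs i. length xs = n \<and> i < n \<longrightarrow> Vector_Spaces.linear scale scale (\<lambda>v. f (xs[i := v]))) \<and>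
    (\<forall>xs i j. length xs = n \<and> i < j \<and> j < n \<and> xs ! i = xs ! j \<longrightarrow> f xs = 0) \<and>
    (\<forall>xs. length xs = n \<longrightarrow> \<alpha> (f xs) = f (map \<alpha> xs))}"

text \<open>Shuffles act on the positions \<open>0, \<dots>, p + q - 1\<close>, matching list indices.\<close>

definition Sh :: "nat \<Rightarrow> nat \<Rightarrow> (nat \<Rightarrow> nat) set"
  where "Sh p q = {\<sigma>. \<sigma> permutes {..<p + q} \<and>
    strict_mono_on {..<p} \<sigma> \<and> strict_mono_on {p..<p + q} \<sigma>}"

text \<open>\<open>nr_comp scale \<alpha> m n P Q\<close> is the diamond product of \<open>P\<close> of degree \<open>m\<close> (arity \<open>m + 1\<close>) and
  \<open>Q\<close> of degree \<open>n\<close> (arity \<open>n + 1\<close>).  The degrees are explicit arguments, since the zero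
  cochain is homogeneous of every degree.\<close>

definition nr_comp ::
  "('k::field_char_0 \<Rightarrow> 'g::ab_group_add \<Rightarrow> 'g) \<Rightarrow> ('g \<Rightarrow> 'g) \<Rightarrow> nat \<Rightarrow> nat \<Rightarrow>
    ('g list \<Rightarrow> 'g) \<Rightarrow> ('g list \<Rightarrow> 'g) \<Rightarrow> 'g list \<Rightarrow> 'g"
  where "nr_comp scale \<alpha> m n P Q xs =
    (if length xs = m + n + 1 then
       \<Sum>\<sigma>\<in>Sh (n + 1) m. scale (of_int (sign \<sigma>))
         (P (Q (map (\<lambda>i. xs ! \<sigma> i) [0..<n + 1]) #
             map (\<lambda>i. (\<alpha> ^^ n) (xs ! \<sigma> i)) [n + 1..<m + n + 1]))
     else 0)"

definition nr_bracket ::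
  "('k::field_char_0 \<Rightarrow> 'g::ab_group_add \<Rightarrow> 'g) \<Rightarrow> ('g \<Rightarrow> 'g) \<Rightarrow> nat \<Rightarrow> nat \<Rightarrow>
    ('g list \<Rightarrow> 'g) \<Rightarrow> ('g list \<Rightarrow> 'g) \<Rightarrow> 'g list \<Rightarrow> 'g"
  where "nr_bracket scale \<alpha> m n P Q =
    nr_comp scale \<alpha> m n P Q - (\<lambda>xs. scale ((- 1) ^ (m * n)) (nr_comp scale \<alpha> n m Q P xs))"

text \<open>Maurer-Cartan elements of a bidifferential graded Lie algebra, given by its graded pieces
  \<open>L i\<close> inside an ambient space with scalar multiplication \<open>scale\<close>, the bracket
  \<open>br i j\<close> on \<open>L i \<times> L j\<close>, and the differentials \<open>d1 i\<close>, \<open>d2 i\<close> on \<open>L i\<close>.  The axioms of a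
  bidifferential graded Lie algebra do not enter the definition.\<close>

definition maurer_cartan ::
  "('k::field_char_0 \<Rightarrow> 'v::ab_group_add \<Rightarrow> 'v) \<Rightarrow> (nat \<Rightarrow> 'v set) \<Rightarrow>
    (nat \<Rightarrow> nat \<Rightarrow> 'v \<Rightarrow> 'v \<Rightarrow> 'v) \<Rightarrow> (nat \<Rightarrow> 'v \<Rightarrow> 'v) \<Rightarrow> (nat \<Rightarrow> 'v \<Rightarrow> 'v) \<Rightarrow> ('v \<times> 'v) set"
  where "maurer_cartan scale L br d1 d2 = {(\<theta>1, \<theta>2). \<theta>1 \<in> L 1 \<and> \<theta>2 \<in> L 1 \<and>
    d1 1 \<theta>1 + scale (1 / 2) (br 1 1 \<theta>1 \<theta>1) = 0 \<and>
    d2 1 \<theta>2 + scale (1 / 2) (br 1 1 \<theta>2 \<theta>2) = 0 \<and>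
    d1 1 \<theta>2 + d2 1 \<theta>1 + br 1 1 \<theta>1 \<theta>2 = 0}"

definition bracket_cochain :: "('g \<Rightarrow> 'g \<Rightarrow> 'g) \<Rightarrow> 'g list \<Rightarrow> 'g::zero"
  where "bracket_cochain br xs = (if length xs = 2 then br (xs ! 0) (xs ! 1) else 0)"

end

theory Submission
  imports Defs
begin

text \<open>Reading a bilinear bracket as a cochain of arity two identifies the multiplicative skew
  brackets with the elements of degree one in the graded Lie algebra; in characteristic zero
  skew and alternating are the same.  The whole content is then that the Nijenhuis-Richardson
  bracket of two such cochains is a polarised Jacobi expression.  Indeed, there are just three
  \<open>(2, 1)\<close>-shuffles, and their signed sum makes \<open>P \<diamond> Q\<close> the cyclic sum
  \<open>J(P, Q) = P(Q(x, y), \<alpha> z) + P(Q(y, z), \<alpha> x) + P(Q(z, x), \<alpha> y)\<close>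
  (\<open>sum_Sh_2_1\<close>, \<open>nr_comp_bracket_cochain\<close>).  Both arguments have degree one, so
  \<open>[P, Q] = J(P, Q) + J(Q, P)\<close> with a plus sign.

  Hence \<open>[P, P] / 2 = J(P, P)\<close> vanishes exactly when \<open>P\<close> satisfies the Hom-Jacobi identity.
  Moreover \<open>J\<close> is bilinear, so that a combination \<open>l P + e Q\<close> has Jacobi expression
  \<open>l\<^sup>2 J(P, P) + l e (J(P, Q) + J(Q, P)) + e\<^sup>2 J(Q, Q)\<close>.  For two Hom-Lie brackets this
  vanishes for all \<open>l\<close> and \<open>e\<close> exactly when the mixed term \<open>[P, Q]\<close> does, which is the
  remaining Maurer-Cartan equation (\<open>compatible_hom_lie_algebra_iff\<close>).\<close>

section \<open>Shuffles of type (2, 1)\<close>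

text \<open>A \<open>(2, 1)\<close>-shuffle is determined by its value at the last position, since the other two
  values are taken in increasing order; the permutations listed have the last values 2, 1 and 0.\<close>

lemma Sh_2_1:
  "Sh 2 1 = {id, transpose 1 2, transpose 0 1 \<circ> transpose 1 2}"
proof (intro equalityI subsetI)
  fix \<sigma> assume "\<sigma> \<in> Sh 2 1"
  then have perm: "\<sigma> permutes {..<3}" and mono: "strict_mono_on {..<2} \<sigma>"
    by (auto simp: Sh_def)
  have less: "\<sigma> 0 < \<sigma> 1"
    using mono by (auto simp: strict_mono_on_def)
  have range: "\<sigma> i < 3" if "i < 3" for i
    using permutes_in_image[OF perm, of i] that by simp
  have neq: "\<sigma> 0 \<noteq> \<sigma> 2" "\<sigma> 1 \<noteq> \<sigma> 2"
    using permutes_inj[OF perm] by (auto simp: inj_eq)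
  have outside: "\<sigma> i = i" if "i \<ge> 3" for i
    using permutes_not_in[OF perm, of i] that by simp
  have eqI: "\<sigma> = \<tau>" if "\<sigma> 0 = \<tau> 0" "\<sigma> 1 = \<tau> 1" "\<sigma> 2 = \<tau> 2" "\<And>i. i \<ge> 3 \<Longrightarrow> \<tau> i = i" for \<tau>
  proof
    fix i :: nat
    consider "i = 0" | "i = 1" | "i = 2" | "i \<ge> 3" by linarith
    then show "\<sigma> i = \<tau> i" using that outside by cases auto
  qed
  consider "\<sigma> 0 = 0" "\<sigma> 1 = 1" "\<sigma> 2 = 2" | "\<sigma> 0 = 0" "\<sigma> 1 = 2" "\<sigma> 2 = 1"
    | "\<sigma> 0 = 1" "\<sigma> 1 = 2" "\<sigma> 2 = 0"
    using less range[of 0] range[of 1] range[of 2] neq by linarith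
  then show "\<sigma> \<in> {id, transpose 1 2, transpose 0 1 \<circ> transpose 1 2}"
  proof cases
    case 1
    then have "\<sigma> = id" by (intro eqI) auto
    then show ?thesis by simp
  next
    case 2
    then have "\<sigma> = transpose 1 2" by (intro eqI) (auto simp: transpose_def)
    then show ?thesis by simp
  next
    case 3
    then have "\<sigma> = transpose 0 1 \<circ> transpose 1 2" by (intro eqI) (auto simp: transpose_def)
    then show ?thesis by simp
  qed
next
  fix \<sigma> :: "nat \<Rightarrow> nat"
  have transp: "transpose a b permutes {..<3}" if "a < 3" "b < 3" for a b :: nat
    using that by (intro permutes_swap_id) auto
  assume "\<sigma> \<in> {id, transpose 1 2, transpose 0 1 \<circ> transpose 1 2}"
  then have "\<sigma> permutes {..<3}" "\<sigma> 0 < \<sigma> 1"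
    using transp permutes_id by (auto intro!: permutes_compose simp: transpose_def)
  then show "\<sigma> \<in> Sh 2 1"
    by (auto simp: Sh_def strict_mono_on_def less_2_cases_iff)
qed

lemma sum_Sh_2_1:
  "(\<Sum>\<sigma>\<in>Sh 2 1. F \<sigma>) = F id + F (transpose 1 2) + F (transpose 0 1 \<circ> transpose 1 2)"
proof -
  let ?\<tau> = "transpose 1 2 :: nat \<Rightarrow> nat"
  let ?\<rho> = "transpose 0 1 \<circ> transpose 1 2 :: nat \<Rightarrow> nat"
  \<comment> \<open>The three shuffles differ in their values at 2.\<close>
  have "id 2 = (2::nat)" "?\<tau> 2 = 1" "?\<rho> 2 = 0"
    by (simp_all add: transpose_def)
  then have "id \<noteq> ?\<tau>" "id \<noteq> ?\<rho>" "?\<tau> \<noteq> ?\<rho>"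
    by (metis zero_neq_numeral one_eq_numeral_iff semiring_norm(85) zero_neq_one)+
  then show ?thesis
    unfolding Sh_2_1 by (simp add: add.assoc)
qed

section \<open>Cochains of arity two as brackets\<close>

lemma bracket_cochain_pair [simp]: "bracket_cochain br [x, y] = br x y"
  by (simp add: bracket_cochain_def)

lemma length_2_iff: "length xs = 2 \<longleftrightarrow> (\<exists>x y. xs = [x, y])"
  by (auto simp: numeral_2_eq_2 length_Suc_conv)

lemma hom_cochain_2_eq_bracket_cochain:
  assumes "f \<in> hom_cochains scale \<alpha> 2"
  shows "f = bracket_cochain (\<lambda>x y. f [x, y])"
proof
  fix xs show "f xs = bracket_cochain (\<lambda>x y. f [x, y]) xs"
    using assms by (cases "length xs = 2")
      (auto simp: hom_cochains_def bracket_cochain_def length_2_iff)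
qed

lemma bracket_cochain_in_hom_cochains_iff:
  "bracket_cochain br \<in> hom_cochains scale \<alpha> 2 \<longleftrightarrow>
    (\<forall>y. Vector_Spaces.linear scale scale (\<lambda>x. br x y)) \<and>
    (\<forall>x. Vector_Spaces.linear scale scale (\<lambda>y. br x y)) \<and>
    (\<forall>x. br x x = 0) \<and> (\<forall>x y. \<alpha> (br x y) = br (\<alpha> x) (\<alpha> y))"
proof -
  have lin: "(\<forall>xs i. length xs = 2 \<and> i < 2 \<longrightarrow>
        Vector_Spaces.linear scale scale (\<lambda>v. bracket_cochain br (xs[i := v]))) \<longleftrightarrow>
      (\<forall>y. Vector_Spaces.linear scale scale (\<lambda>x. br x y)) \<and>
      (\<forall>x. Vector_Spaces.linear scale scale (\<lambda>y. br x y))" (is "?M \<longleftrightarrow> ?B")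
  proof
    assume M: ?M
    have "Vector_Spaces.linear scale scale (\<lambda>x. br x y)" for y
      using M[rule_format, of "[0, y]" 0] by simp
    moreover have "Vector_Spaces.linear scale scale (\<lambda>y. br x y)" for x
      using M[rule_format, of "[x, 0]" 1] by simp
    ultimately show ?B by blast
  next
    assume ?B
    then show ?M by (auto simp: length_2_iff less_2_cases_iff)
  qed
  have alt: "(\<forall>xs i j. length xs = 2 \<and> i < j \<and> j < 2 \<and> xs ! i = xs ! j \<longrightarrow>
        bracket_cochain br xs = 0) \<longleftrightarrow> (\<forall>x. br x x = 0)" (is "?M \<longleftrightarrow> ?B")
  proof
    assume M: ?M
    show ?B
      using M[rule_format, of "[x, x]" 0 1 for x] by simp
  qed (auto simp: length_2_iff less_2_cases_iff)
  have mult: "(\<forall>xs. length xs = 2 \<longrightarrow> \<alpha> (bracket_cochain br xs) = bracket_cochain br (map \<alpha> xs)) \<longleftrightarrow>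
      (\<forall>x y. \<alpha> (br x y) = br (\<alpha> x) (\<alpha> y))" (is "?M \<longleftrightarrow> ?B")
  proof
    assume M: ?M
    show ?B
      using M[rule_format, of "[x, y]" for x y] by simp
  qed (auto simp: length_2_iff)
  have "length xs \<noteq> 2 \<Longrightarrow> bracket_cochain br xs = 0" for xs
    by (simp add: bracket_cochain_def)
  then show ?thesis
    unfolding hom_cochains_def mem_Collect_eq lin alt mult by blast
qed

lemma bracket_cochainD:
  assumes "bracket_cochain br \<in> hom_cochains scale \<alpha> 2"
  shows "br (x + x') y = br x y + br x' y" "br x (y + y') = br x y + br x y'"
    and "br (scale c x) y = scale c (br x y)" "br x (scale c y) = scale c (br x y)"
    and "br x x = 0" "\<alpha> (br x y) = br (\<alpha> x) (\<alpha> y)"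
proof -
  have "Vector_Spaces.linear scale scale (\<lambda>x. br x y)"
    and "Vector_Spaces.linear scale scale (\<lambda>y. br x y)"
    and "br x x = 0" "\<alpha> (br x y) = br (\<alpha> x) (\<alpha> y)" for x y
    using assms by (auto simp: bracket_cochain_in_hom_cochains_iff)
  then show "br (x + x') y = br x y + br x' y" "br x (y + y') = br x y + br x y'"
    and "br (scale c x) y = scale c (br x y)" "br x (scale c y) = scale c (br x y)"
    and "br x x = 0" "\<alpha> (br x y) = br (\<alpha> x) (\<alpha> y)"
    by (auto simp: Vector_Spaces.linear_iff)
qed

text \<open>Expand \<open>br (x + y) (x + y) = 0\<close>.\<close>

lemma bracket_cochain_skew:
  assumes "bracket_cochain br \<in> hom_cochains scale \<alpha> 2"
  shows "br x y = - br y x"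
proof -
  have "br (x + y) (x + y) = br x x + br x y + (br y x + br y y)"
    by (simp add: bracket_cochainD(1,2)[OF assms] add_ac)
  then have "br x y + br y x = 0"
    by (simp add: bracket_cochainD(5)[OF assms])
  then show ?thesis by (simp add: eq_neg_iff_add_eq_0)
qed

section \<open>The Nijenhuis-Richardson bracket in degree one\<close>

text \<open>The left-hand side of the Hom-Jacobi identity with the outer and the inner bracket decoupled;
  the identity itself is the diagonal case \<open>P = Q\<close>.\<close>

definition jacobi_sum ::
  "('g \<Rightarrow> 'g) \<Rightarrow> ('g \<Rightarrow> 'g \<Rightarrow> 'g) \<Rightarrow> ('g \<Rightarrow> 'g \<Rightarrow> 'g) \<Rightarrow> 'g \<Rightarrow> 'g \<Rightarrow> 'g \<Rightarrow> 'g::ab_group_add"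
  where "jacobi_sum \<alpha> P Q x y z = P (Q x y) (\<alpha> z) + P (Q y z) (\<alpha> x) + P (Q z x) (\<alpha> y)"

text \<open>The shuffle exchanging the last two positions contributes \<open>- P (Q x z) (\<alpha> y)\<close>, which is
  the third cyclic term because \<open>Q\<close> is skew and \<open>P\<close> linear in its first argument.\<close>

lemma nr_comp_bracket_cochain:
  assumes "vector_space scale"
    and P: "bracket_cochain P \<in> hom_cochains scale \<alpha> 2"
    and Q: "bracket_cochain Q \<in> hom_cochains scale \<alpha> 2"
  shows "nr_comp scale \<alpha> 1 1 (bracket_cochain P) (bracket_cochain Q) [x, y, z] =
    jacobi_sum \<alpha> P Q x y z"
proof -
  interpret vector_space scale by fact
  have signs: "sign (transpose 1 2 :: nat \<Rightarrow> nat) = -1"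
      "sign (transpose 0 1 \<circ> transpose 1 2 :: nat \<Rightarrow> nat) = 1"
    by (simp_all add: sign_swap_id sign_compose permutation_swap_id)
  have [simp]: "[0..<2] = [0, 1::nat]" "[2..<3] = [2::nat]"
    by (simp_all add: upt_rec)
  have "Q x z = scale (- 1) (Q z x)"
    using bracket_cochain_skew[OF Q, of x z] by simp
  then have "scale (- 1) (P (Q x z) (\<alpha> y)) = P (Q z x) (\<alpha> y)"
    by (simp only: bracket_cochainD(3)[OF P]) simp
  then have third: "- P (Q x z) (\<alpha> y) = P (Q z x) (\<alpha> y)" by simp
  have "nr_comp scale \<alpha> 1 1 (bracket_cochain P) (bracket_cochain Q) [x, y, z] =
      (\<Sum>\<sigma>\<in>Sh 2 1. scale (of_int (sign \<sigma>))
        (P (Q ([x, y, z] ! \<sigma> 0) ([x, y, z] ! \<sigma> 1)) (\<alpha> ([x, y, z] ! \<sigma> 2))))"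
    by (simp add: nr_comp_def numeral_2_eq_2[symmetric] numeral_3_eq_3[symmetric])
  also have "\<dots> = P (Q x y) (\<alpha> z) + - P (Q x z) (\<alpha> y) + P (Q y z) (\<alpha> x)"
    unfolding sum_Sh_2_1 signs by (simp add: transpose_def)
  also have "\<dots> = jacobi_sum \<alpha> P Q x y z"
    unfolding third by (simp add: jacobi_sum_def add_ac)
  finally show ?thesis .
qed

lemma nr_bracket_bracket_cochain:
  assumes "vector_space scale"
    and "bracket_cochain P \<in> hom_cochains scale \<alpha> 2"
    and "bracket_cochain Q \<in> hom_cochains scale \<alpha> 2"
  shows "nr_bracket scale \<alpha> 1 1 (bracket_cochain P) (bracket_cochain Q) [x, y, z] =
    jacobi_sum \<alpha> P Q x y z + jacobi_sum \<alpha> Q P x y z"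
proof -
  interpret vector_space scale by fact
  show ?thesis
    using nr_comp_bracket_cochain[OF assms, of x y z]
      nr_comp_bracket_cochain[OF assms(1,3,2), of x y z]
    by (simp add: nr_bracket_def)
qed

lemma nr_bracket_1_1_eq_0_outside:
  assumes "vector_space scale" and "length xs \<noteq> 3"
  shows "nr_bracket scale \<alpha> 1 1 P Q xs = 0"
proof -
  interpret vector_space scale by fact
  show ?thesis using assms(2) by (simp add: nr_bracket_def nr_comp_def)
qed

lemma nr_bracket_eq_0_iff:
  assumes "vector_space scale"
    and "bracket_cochain P \<in> hom_cochains scale \<alpha> 2"
    and "bracket_cochain Q \<in> hom_cochains scale \<alpha> 2"
  shows "nr_bracket scale \<alpha> 1 1 (bracket_cochain P) (bracket_cochain Q) = 0 \<longleftrightarrow>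
    (\<forall>x y z. jacobi_sum \<alpha> P Q x y z + jacobi_sum \<alpha> Q P x y z = 0)" (is "?B = 0 \<longleftrightarrow> ?J")
proof
  assume "?B = 0"
  then show ?J
    by (simp flip: nr_bracket_bracket_cochain[OF assms])
next
  assume J: ?J
  have "?B xs = 0" for xs
  proof (cases "length xs = 3")
    case True
    then obtain x y z where "xs = [x, y, z]"
      by (auto simp: numeral_3_eq_3 length_Suc_conv)
    with J show ?thesis by (simp only: nr_bracket_bracket_cochain[OF assms])
  qed (simp only: nr_bracket_1_1_eq_0_outside[OF assms(1)] not_False_eq_True)
  then show "?B = 0" by (simp add: fun_eq_iff)
qed

text \<open>In degree one \<open>[P, P] = 2 J(P, P)\<close>, and 2 is invertible.\<close>

lemma half_nr_bracket_self_eq_0_iff: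
  fixes scale :: "'k::field_char_0 \<Rightarrow> 'g::ab_group_add \<Rightarrow> 'g"
  assumes "vector_space scale"
    and "bracket_cochain P \<in> hom_cochains scale \<alpha> 2"
  shows "(\<lambda>xs. scale (1 / 2) (nr_bracket scale \<alpha> 1 1 (bracket_cochain P) (bracket_cochain P) xs)) = 0
    \<longleftrightarrow> (\<forall>x y z. jacobi_sum \<alpha> P P x y z = 0)"
proof -
  interpret vector_space scale by fact
  have double: "v + v = 0 \<longleftrightarrow> v = 0" for v :: 'g
    using scale_left_distrib[of 1 1 v] scale_eq_0_iff[of 2 v] by simp
  show ?thesis
    using nr_bracket_eq_0_iff[OF assms assms(2)] by (simp add: fun_eq_iff double)
qed

section \<open>Hom-Lie and compatible Hom-Lie structures\<close>

text \<open>The passage from skew to alternating divides \<open>br x x = - br x x\<close> by two.\<close>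

lemma hom_lie_algebra_iff:
  fixes scale :: "'k::field_char_0 \<Rightarrow> 'g::ab_group_add \<Rightarrow> 'g"
  assumes "vector_space scale" and "Vector_Spaces.linear scale scale \<alpha>"
  shows "hom_lie_algebra scale br \<alpha> \<longleftrightarrow>
    bracket_cochain br \<in> hom_cochains scale \<alpha> 2 \<and> (\<forall>x y z. jacobi_sum \<alpha> br br x y z = 0)"
proof
  assume "hom_lie_algebra scale br \<alpha>"
  then interpret hom_lie_algebra scale br \<alpha> .
  have "br x x = 0" for x
    using skew[of x x] scale_left_distrib[of 1 1 "br x x"] scale_eq_0_iff[of 2 "br x x"]
    by (simp add: eq_neg_iff_add_eq_0)
  then show "bracket_cochain br \<in> hom_cochains scale \<alpha> 2 \<and> (\<forall>x y z. jacobi_sum \<alpha> br br x y z = 0)"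
    by (simp add: bracket_cochain_in_hom_cochains_iff linear_left linear_right multiplicative
        jacobi_sum_def hom_jacobi)
next
  assume *: "bracket_cochain br \<in> hom_cochains scale \<alpha> 2 \<and> (\<forall>x y z. jacobi_sum \<alpha> br br x y z = 0)"
  show "hom_lie_algebra scale br \<alpha>"
  proof (intro hom_lie_algebra.intro hom_lie_algebra_axioms.intro assms)
    show "br x y = - br y x" for x y
      using * bracket_cochain_skew by blast
  qed (use * in \<open>auto simp: bracket_cochain_in_hom_cochains_iff jacobi_sum_def\<close>)
qed

lemma bracket_cochain_combination:
  assumes "vector_space scale" and "Vector_Spaces.linear scale scale \<alpha>"
    and "bracket_cochain P \<in> hom_cochains scale \<alpha> 2"
    and "bracket_cochain Q \<in> hom_cochains scale \<alpha> 2"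
  shows "bracket_cochain (\<lambda>x y. scale l (P x y) + scale e (Q x y)) \<in> hom_cochains scale \<alpha> 2"
proof -
  interpret vector_space scale by fact
  show ?thesis
    using assms(1,2)
    unfolding bracket_cochain_in_hom_cochains_iff Vector_Spaces.linear_iff
    by (auto simp: bracket_cochainD[OF assms(3)] bracket_cochainD[OF assms(4)]
        scale_right_distrib mult_ac add_ac)
qed

lemma jacobi_sum_combination:
  fixes scale :: "'k::field_char_0 \<Rightarrow> 'g::ab_group_add \<Rightarrow> 'g"
  assumes "vector_space scale"
    and "bracket_cochain P \<in> hom_cochains scale \<alpha> 2"
    and "bracket_cochain Q \<in> hom_cochains scale \<alpha> 2"
  defines "R l e \<equiv> \<lambda>x y. scale l (P x y) + scale e (Q x y)"
  shows "jacobi_sum \<alpha> (R l e) (R l e) x y z =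
    scale (l * l) (jacobi_sum \<alpha> P P x y z) +
    scale (l * e) (jacobi_sum \<alpha> P Q x y z + jacobi_sum \<alpha> Q P x y z) +
    scale (e * e) (jacobi_sum \<alpha> Q Q x y z)"
proof -
  interpret vector_space scale by fact
  show ?thesis
    by (simp add: jacobi_sum_def R_def bracket_cochainD[OF assms(2)] bracket_cochainD[OF assms(3)]
        scale_right_distrib mult_ac add_ac)
qed

text \<open>The squares \<open>J(P, P)\<close> and \<open>J(Q, Q)\<close> vanish for Hom-Lie brackets \<open>P\<close> and \<open>Q\<close>, so compatibility concerns only
  the mixed term; the combination with both coefficients 1 already forces it to be zero.\<close>

lemma compatible_hom_lie_algebra_iff:
  fixes scale :: "'k::field_char_0 \<Rightarrow> 'g::ab_group_add \<Rightarrow> 'g"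
  assumes "vector_space scale" and "Vector_Spaces.linear scale scale \<alpha>"
  shows "compatible_hom_lie_algebra scale br1 br2 \<alpha> \<longleftrightarrow>
    hom_lie_algebra scale br1 \<alpha> \<and> hom_lie_algebra scale br2 \<alpha> \<and>
    (\<forall>x y z. jacobi_sum \<alpha> br1 br2 x y z + jacobi_sum \<alpha> br2 br1 x y z = 0)" (is "?C \<longleftrightarrow> ?R")
proof -
  interpret vector_space scale by fact
  note iff = hom_lie_algebra_iff[OF assms]
  have "(\<forall>l e. hom_lie_algebra scale (\<lambda>x y. scale l (br1 x y) + scale e (br2 x y)) \<alpha>) \<longleftrightarrow>
      (\<forall>x y z. jacobi_sum \<alpha> br1 br2 x y z + jacobi_sum \<alpha> br2 br1 x y z = 0)"
    (is "(\<forall>l e. ?H l e) \<longleftrightarrow> ?J")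
    if h1: "hom_lie_algebra scale br1 \<alpha>" and h2: "hom_lie_algebra scale br2 \<alpha>"
  proof -
    have c: "bracket_cochain br1 \<in> hom_cochains scale \<alpha> 2"
        "bracket_cochain br2 \<in> hom_cochains scale \<alpha> 2"
      using h1 h2 iff by auto
    have H: "?H l e \<longleftrightarrow> (\<forall>x y z. scale (l * e)
        (jacobi_sum \<alpha> br1 br2 x y z + jacobi_sum \<alpha> br2 br1 x y z) = 0)" for l e
      using h1 h2 unfolding iff jacobi_sum_combination[OF assms(1) c]
      by (simp add: bracket_cochain_combination[OF assms c])
    show ?thesis
    proof
      assume "\<forall>l e. ?H l e"
      then have "?H 1 1" by blast
      then show ?J unfolding H by simp
    next
      assume ?J
      then show "\<forall>l e. ?H l e" unfolding H by simp
    qed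
  qed
  moreover have "?C \<longleftrightarrow> hom_lie_algebra scale br1 \<alpha> \<and> hom_lie_algebra scale br2 \<alpha> \<and>
      (\<forall>l e. hom_lie_algebra scale (\<lambda>x y. scale l (br1 x y) + scale e (br2 x y)) \<alpha>)"
    by (auto simp: compatible_hom_lie_algebra_def compatible_hom_lie_algebra_axioms_def)
  ultimately show ?thesis by blast
qed

section \<open>The correspondence\<close>

lemma bracket_cochains_maurer_cartan_iff:
  fixes scale :: "'k::field_char_0 \<Rightarrow> 'g::ab_group_add \<Rightarrow> 'g"
  assumes "vector_space scale" and "Vector_Spaces.linear scale scale \<alpha>"
  shows "(bracket_cochain br1, bracket_cochain br2) \<in>
      maurer_cartan (\<lambda>c f xs. scale c (f xs)) (\<lambda>n. hom_cochains scale \<alpha> (n + 1))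
        (nr_bracket scale \<alpha>) (\<lambda>_ _. 0) (\<lambda>_ _. 0) \<longleftrightarrow>
    (br1, br2) \<in> compatible_hom_lie_structures scale \<alpha>"
proof (cases "bracket_cochain br1 \<in> hom_cochains scale \<alpha> 2 \<and>
    bracket_cochain br2 \<in> hom_cochains scale \<alpha> 2")
  case True
  then have c: "bracket_cochain br1 \<in> hom_cochains scale \<alpha> 2"
      "bracket_cochain br2 \<in> hom_cochains scale \<alpha> 2" by auto
  show ?thesis
    using c half_nr_bracket_self_eq_0_iff[OF assms(1) c(1)]
      half_nr_bracket_self_eq_0_iff[OF assms(1) c(2)] nr_bracket_eq_0_iff[OF assms(1) c]
    unfolding maurer_cartan_def compatible_hom_lie_structures_def mem_Collect_eq prod.case
      compatible_hom_lie_algebra_iff[OF assms] hom_lie_algebra_iff[OF assms] one_add_one add_0_left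
    by blast
next
  case False
  then show ?thesis
    by (auto simp: maurer_cartan_def compatible_hom_lie_structures_def
        compatible_hom_lie_algebra_iff[OF assms] hom_lie_algebra_iff[OF assms] one_add_one
        simp flip: numeral_2_eq_2)
qed

theorem theorem3p12:
  fixes scale :: "'k::field_char_0 \<Rightarrow> 'g::ab_group_add \<Rightarrow> 'g"
    and \<alpha> :: "'g \<Rightarrow> 'g"
  assumes "vector_space scale"
    and "Vector_Spaces.linear scale scale \<alpha>"
  shows "bij_betw (\<lambda>(br1, br2). (bracket_cochain br1, bracket_cochain br2))
    (compatible_hom_lie_structures scale \<alpha>)
    (maurer_cartan (\<lambda>c f xs. scale c (f xs)) (\<lambda>n. hom_cochains scale \<alpha> (n + 1))
       (nr_bracket scale \<alpha>) (\<lambda>_ _. 0) (\<lambda>_ _. 0))"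
    (is "bij_betw ?\<Phi> ?S ?MC")
proof (rule bij_betw_byWitness[where f' = "\<lambda>(f, g). (\<lambda>x y. f [x, y], \<lambda>x y. g [x, y])"])
  let ?\<Psi> = "\<lambda>(f, g). (\<lambda>x y. f [x, y], \<lambda>x y. g [x, y])"
  have right_inv: "?\<Phi> (?\<Psi> \<theta>) = \<theta>" if "\<theta> \<in> ?MC" for \<theta>
    using that by (auto simp: maurer_cartan_def one_add_one simp flip: numeral_2_eq_2
        hom_cochain_2_eq_bracket_cochain)
  show "\<forall>b\<in>?S. ?\<Psi> (?\<Phi> b) = b" by auto
  show "\<forall>\<theta>\<in>?MC. ?\<Phi> (?\<Psi> \<theta>) = \<theta>" using right_inv by blast
  show "?\<Phi> ` ?S \<subseteq> ?MC"
    using bracket_cochains_maurer_cartan_iff[OF assms] by auto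
  show "?\<Psi> ` ?MC \<subseteq> ?S"
  proof (rule image_subsetI)
    fix \<theta> assume "\<theta> \<in> ?MC"
    then have "?\<Phi> (?\<Psi> \<theta>) \<in> ?MC" by (simp only: right_inv)
    then show "?\<Psi> \<theta> \<in> ?S"
      unfolding prod.case_eq_if
      by (simp only: fst_conv snd_conv bracket_cochains_maurer_cartan_iff[OF assms])
  qed
qed

end
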